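(* Let $P(\lambda)=A_m\lambda^m+\dots+A_1\lambda+A_0$ be an $n\times n$ quaternion matrix polynomial whose coefficients $A_i\in M_n(\mathbb{H})$ satisfy $A_m\succeq A_{m-1}\succeq\dots\succeq A_0\succ0$. Then each right eigenvalue $\lambda_0$ of $P(\lambda)$ satisfies $$\frac{\lambda_{\min}(A_0)}{2\lambda_{\max}(A_m)}\le|\lambda_0|\le1,$$ where $\lambda_{\min}(A_0)$ denotes the smallest right eigenvalue of $A_0$ and $\lambda_{\max}(A_m)$ denotes the largest right eigenvalue of $A_m$.
   Context: $\mathbb{H}$ denotes the real quaternions with modulus $|\cdot|$, and $M_n(\mathbb{H})$ is the set of $n\times n$ quaternion matrices; $x^*$ denotes the conjugate transpose. $A\in M_n(\mathbb{H})$ is positive semidefinite, written $A\succeq0$, if $x^*Ax\ge0$ for every $x\in\mathbb{H}^n$, and positive definite, written $A\succ0$, if $x^*Ax>0$ for every nonzero $x\in\mathbb{H}^n$; $A\succeq B$ means $A-B\succeq0$. A right eigenvalue of a matrix $A\in M_n(\mathbb{H})$ is a quaternion $\lambda_0$ with $Ay=y\lambda_0$ for some nonzero $y\in\mathbb{H}^n$; the right eigenvalues of a positive definite matrix are positive real numbers. A right eigenvalue of $P(\lambda)=\sum_{i=0}^m A_i\lambda^i$ is a quaternion $\lambda_0$ with $\sum_{i=0}^m A_i y\lambda_0^i=0$ for some nonzero $y\in\mathbb{H}^n$. *)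

theory Defs
  imports "HOL-Analysis.Analysis"
begin

section \<open>The real quaternions\<close>

text \<open>\<^term>\<open>Quat a b c d\<close> stands for the quaternion $a + bi + cj + dk$.\<close>

codatatype quat = Quat (qRe: real) (qI: real) (qJ: real) (qK: real)

lemma quat_eqI [intro?]:
  "qRe x = qRe y \<Longrightarrow> qI x = qI y \<Longrightarrow> qJ x = qJ y \<Longrightarrow> qK x = qK y \<Longrightarrow> x = y"
  by (rule quat.expand) simp

lemma quat_eq_iff:
  "x = y \<longleftrightarrow> qRe x = qRe y \<and> qI x = qI y \<and> qJ x = qJ y \<and> qK x = qK y"
  by (auto intro: quat.expand)

instantiation quat :: ab_group_add
begin

primcorec zero_quat where
  "qRe 0 = 0" | "qI 0 = 0" | "qJ 0 = 0" | "qK 0 = 0"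

primcorec plus_quat where
  "qRe (x + y) = qRe x + qRe y"
| "qI (x + y) = qI x + qI y"
| "qJ (x + y) = qJ x + qJ y"
| "qK (x + y) = qK x + qK y"

primcorec uminus_quat where
  "qRe (- x) = - qRe x" | "qI (- x) = - qI x" | "qJ (- x) = - qJ x" | "qK (- x) = - qK x"

primcorec minus_quat where
  "qRe (x - y) = qRe x - qRe y"
| "qI (x - y) = qI x - qI y"
| "qJ (x - y) = qJ x - qJ y"
| "qK (x - y) = qK x - qK y"

instance
  by standard (simp_all add: quat_eq_iff)

end

instantiation quat :: ring_1
begin

primcorec one_quat where
  "qRe 1 = 1" | "qI 1 = 0" | "qJ 1 = 0" | "qK 1 = 0"

primcorec times_quat where
  "qRe (x * y) = qRe x * qRe y - qI x * qI y - qJ x * qJ y - qK x * qK y"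
| "qI (x * y) = qRe x * qI y + qI x * qRe y + qJ x * qK y - qK x * qJ y"
| "qJ (x * y) = qRe x * qJ y - qI x * qK y + qJ x * qRe y + qK x * qI y"
| "qK (x * y) = qRe x * qK y + qI x * qJ y - qJ x * qI y + qK x * qRe y"

instance
  by standard (simp_all add: quat_eq_iff algebra_simps)

end

instantiation quat :: real_algebra_1
begin

primcorec scaleR_quat where
  "qRe (scaleR r x) = r * qRe x"
| "qI (scaleR r x) = r * qI x"
| "qJ (scaleR r x) = r * qJ x"
| "qK (scaleR r x) = r * qK x"

instance
  by standard (simp_all add: quat_eq_iff algebra_simps)

end

lemma of_real_quat_sel [simp]:
  "qRe (of_real r) = r" "qI (of_real r) = 0" "qJ (of_real r) = 0" "qK (of_real r) = 0"
  by (simp_all add: of_real_def)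

primcorec qcnj :: "quat \<Rightarrow> quat" where
  "qRe (qcnj x) = qRe x" | "qI (qcnj x) = - qI x" | "qJ (qcnj x) = - qJ x" | "qK (qcnj x) = - qK x"

instantiation quat :: real_inner
begin

definition inner_quat :: "quat \<Rightarrow> quat \<Rightarrow> real" where
  "inner_quat x y = qRe x * qRe y + qI x * qI y + qJ x * qJ y + qK x * qK y"

definition norm_quat :: "quat \<Rightarrow> real" where
  "norm_quat x = sqrt ((qRe x)\<^sup>2 + (qI x)\<^sup>2 + (qJ x)\<^sup>2 + (qK x)\<^sup>2)"

definition sgn_quat :: "quat \<Rightarrow> quat" where
  "sgn_quat x = x /\<^sub>R norm x"

definition dist_quat :: "quat \<Rightarrow> quat \<Rightarrow> real" where
  "dist_quat x y = norm (x - y)"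

definition uniformity_quat :: "(quat \<times> quat) filter" where
  "uniformity_quat = (INF e\<in>{0 <..}. principal {(x, y). dist x y < e})"

definition open_quat :: "quat set \<Rightarrow> bool" where
  "open_quat U \<longleftrightarrow> (\<forall>x\<in>U. eventually (\<lambda>(x', y). x' = x \<longrightarrow> y \<in> U) uniformity)"

instance
proof
  fix x y z :: quat and r :: real and U :: "quat set"
  show "inner x x = 0 \<longleftrightarrow> x = 0"
  proof -
    have "qRe x = 0 \<and> qI x = 0 \<and> qJ x = 0 \<and> qK x = 0" if "inner x x = 0"
      using that unfolding inner_quat_def
      by (smt (verit) mult_eq_0_iff zero_le_square)
    then show ?thesis by (auto simp: inner_quat_def quat_eq_iff)
  qed
  show "0 \<le> inner x x" by (simp add: inner_quat_def)
  show "norm x = sqrt (inner x x)"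
    by (simp add: norm_quat_def inner_quat_def power2_eq_square)
qed (auto simp: inner_quat_def sgn_quat_def dist_quat_def uniformity_quat_def open_quat_def
      algebra_simps)

end

lemma norm_quat_sq: "(norm z)\<^sup>2 = (qRe z)\<^sup>2 + (qI z)\<^sup>2 + (qJ z)\<^sup>2 + (qK z)\<^sup>2" for z :: quat
  by (simp add: norm_quat_def)

lemma qcnj_mult_self: "qcnj z * z = of_real ((norm z)\<^sup>2)"
  and mult_qcnj_self: "z * qcnj z = of_real ((norm z)\<^sup>2)"
  unfolding norm_quat_sq by (simp_all add: quat_eq_iff power2_eq_square)

instantiation quat :: real_normed_div_algebra
begin

definition inverse_quat :: "quat \<Rightarrow> quat" where
  "inverse_quat x = qcnj x /\<^sub>R (norm x)\<^sup>2"

definition divide_quat :: "quat \<Rightarrow> quat \<Rightarrow> quat" where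
  "divide_quat x y = x * inverse y"

instance
proof
  fix x y :: quat
  show "inverse x * x = 1" "x * inverse x = 1" if "x \<noteq> 0"
    using that by (simp_all add: inverse_quat_def qcnj_mult_self mult_qcnj_self of_real_def)
  show "x div y = x * inverse y" by (simp add: divide_quat_def)
  show "inverse (0::quat) = 0" by (simp add: inverse_quat_def)
  have "(norm (x * y))\<^sup>2 = (norm x * norm y)\<^sup>2"
    unfolding power_mult_distrib norm_quat_sq times_quat.simps by algebra
  then show "norm (x * y) = norm x * norm y"
    by (metis norm_ge_zero mult_nonneg_nonneg power2_eq_imp_eq)
qed

end

section \<open>Quaternion vectors and matrices\<close>

text \<open>
  The space $\mathbb{H}^n$ is \<^typ>\<open>quat^'n\<close> and $M_n(\mathbb{H})$ is \<^typ>\<open>quat^'n^'n\<close>. The library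
  product \<^const>\<open>matrix_vector_mult\<close> puts the matrix entries on the left, as needed.
\<close>

definition rscale :: "quat^'n \<Rightarrow> quat \<Rightarrow> quat^'n" (infixl \<open>*r\<close> 70) where
  "y *r c = (\<chi> i. y $ i * c)"

text \<open>The scalar $x^* y$, where $x^*$ is the conjugate transpose of the column $x$.\<close>

definition cinner :: "quat^'n \<Rightarrow> quat^'n \<Rightarrow> quat" where
  "cinner x y = (\<Sum>i\<in>UNIV. qcnj (x $ i) * y $ i)"

text \<open>
  For a quaternion, being (strictly) positive includes being real. In particular no separate
  hypothesis that the matrix is Hermitian is imposed.
\<close>

definition psd :: "quat^'n^'n \<Rightarrow> bool" where
  "psd A \<longleftrightarrow> (\<forall>x. cinner x (A *v x) \<in> \<real> \<and> 0 \<le> qRe (cinner x (A *v x)))"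

definition pd :: "quat^'n^'n \<Rightarrow> bool" where
  "pd A \<longleftrightarrow> (\<forall>x. x \<noteq> 0 \<longrightarrow> cinner x (A *v x) \<in> \<real> \<and> 0 < qRe (cinner x (A *v x)))"

definition loewner_ge :: "quat^'n^'n \<Rightarrow> quat^'n^'n \<Rightarrow> bool" (infix \<open>\<succeq>\<close> 50) where
  "A \<succeq> B \<longleftrightarrow> psd (A - B)"

section \<open>Right eigenvalues\<close>

definition right_eigenvalue :: "quat^'n^'n \<Rightarrow> quat \<Rightarrow> bool" where
  "right_eigenvalue A l \<longleftrightarrow> (\<exists>y. y \<noteq> 0 \<and> A *v y = y *r l)"

text \<open>Here \<^term>\<open>A i\<close> for \<^term>\<open>i \<le> m\<close> are the coefficients of $\sum_{i=0}^m A_i \lambda^i$.\<close>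

definition poly_right_eigenvalue :: "nat \<Rightarrow> (nat \<Rightarrow> quat^'n^'n) \<Rightarrow> quat \<Rightarrow> bool" where
  "poly_right_eigenvalue m A l \<longleftrightarrow> (\<exists>y. y \<noteq> 0 \<and> (\<Sum>i\<le>m. (A i *v y) *r l ^ i) = 0)"

text \<open>
  Smallest and largest right eigenvalue, meant for positive definite matrices: by
  \<open>pd_right_eigenvalue\<close> below, ranging over real numbers then loses no right eigenvalue.
\<close>

definition lambda_min :: "quat^'n^'n \<Rightarrow> real" where
  "lambda_min A = (LEAST r. right_eigenvalue A (of_real r))"

definition lambda_max :: "quat^'n^'n \<Rightarrow> real" where
  "lambda_max A = (GREATEST r. right_eigenvalue A (of_real r))"

lemma cinner_self: "cinner x x = of_real ((norm x)\<^sup>2)"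
  by (simp add: cinner_def qcnj_mult_self norm_vec_def L2_set_def sum_nonneg)

lemma pd_right_eigenvalue:
  assumes "pd A" and "right_eigenvalue A l"
  shows "\<exists>r>0. l = of_real r"
proof -
  obtain y where y: "y \<noteq> 0" "A *v y = y *r l"
    using assms(2) by (auto simp: right_eigenvalue_def)
  have "cinner y (A *v y) = cinner y y * l"
    by (simp add: y(2) cinner_def rscale_def sum_distrib_right mult.assoc)
  then have e: "cinner y (A *v y) = (norm y)\<^sup>2 *\<^sub>R l"
    by (simp add: cinner_self scaleR_conv_of_real)
  have "cinner y (A *v y) \<in> \<real>" and pos: "0 < qRe (cinner y (A *v y))"
    using assms(1) y(1) by (auto simp: pd_def)
  then obtain s where s: "cinner y (A *v y) = of_real s" by (auto elim: Reals_cases)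
  have "s > 0" using pos s by simp
  moreover have "l = of_real (s / (norm y)\<^sup>2)"
  proof -
    have "l = (1 / (norm y)\<^sup>2) *\<^sub>R ((norm y)\<^sup>2 *\<^sub>R l)" using y(1) by simp
    also have "\<dots> = of_real (s / (norm y)\<^sup>2)"
      unfolding e[symmetric] s by (simp add: of_real_def)
    finally show ?thesis .
  qed
  ultimately show ?thesis using y(1) by (intro exI[of _ "s / (norm y)\<^sup>2"]) simp
qed

end

theory Submission
  imports Defs
begin

text \<open>
  Let \<open>y \<noteq> 0\<close> satisfy $\sum_i A_i y\,l^i = 0$ and put $a_i = y^* A_i y$. These numbers are real, and
  $0 < a_0 \le a_1 \le \dots \le a_m$. Multiplying by $y^*$ on the left gives the scalar equation
  $\sum_i a_i l^i = 0$, in which the coefficients commute with $l$. This reduces the claim to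
  the Enestroem--Kakeya theorem, whose classical proof (multiply by $l - 1$) works in any normed
  division algebra: it gives $|l| \le 1$ and $a_0 \le 2 a_m |l|$
  (\<open>enestrom_kakeya_upper\<close>, \<open>enestrom_kakeya_lower\<close>).

  It remains to compare $a_0$ and $a_m$ with the extreme eigenvalues, that is, to show
  $\lambda_{\min}(A_0)\,|y|^2 \le a_0$ and $a_m \le \lambda_{\max}(A_m)\,|y|^2$
  (\<open>lambda_min_le_form\<close>, \<open>form_le_lambda_max\<close>). A quaternion matrix whose form $x^* A x$ is
  real-valued is a symmetric operator on the underlying real Euclidean space of dimension $4n$, and
  its real right eigenvalues are the eigenvalues of that operator. The minimum of the Rayleigh
  quotient exists by compactness of the unit sphere and is attained at an eigenvector
  (\<open>symmetric_min_eigenvector\<close>).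
\<close>

section \<open>The Enestroem--Kakeya bounds in a normed division algebra\<close>

lemma enestrom_kakeya_identity:
  fixes a :: "nat \<Rightarrow> real" and l :: "'a::real_normed_div_algebra"
  shows "(\<Sum>i\<le>m. a i *\<^sub>R l ^ i) * (l - 1) =
    a m *\<^sub>R l ^ Suc m - (\<Sum>i<m. (a (Suc i) - a i) *\<^sub>R l ^ Suc i) - a 0 *\<^sub>R 1"
proof (induction m)
  case 0
  show ?case by (simp add: right_diff_distrib)
next
  case (Suc m)
  have "l ^ Suc m * (l - 1) = l ^ Suc (Suc m) - l ^ Suc m"
    by (simp add: right_diff_distrib mult.assoc power_commutes)
  then show ?case
    by (simp add: distrib_right Suc.IH scaleR_diff_left scaleR_diff_right del: power_Suc)
qed

lemma norm_increment_sum_le: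
  fixes a :: "nat \<Rightarrow> real" and l :: "'a::real_normed_div_algebra"
  assumes mono: "\<And>i. i < m \<Longrightarrow> a i \<le> a (Suc i)"
    and bound: "\<And>i. i < m \<Longrightarrow> norm l ^ Suc i \<le> c"
  shows "norm (\<Sum>i<m. (a (Suc i) - a i) *\<^sub>R l ^ Suc i) \<le> (a m - a 0) * c"
proof -
  have "norm (\<Sum>i<m. (a (Suc i) - a i) *\<^sub>R l ^ Suc i) \<le> (\<Sum>i<m. (a (Suc i) - a i) * c)"
  proof (rule sum_norm_le)
    fix i assume i: "i \<in> {..<m}"
    have "norm ((a (Suc i) - a i) *\<^sub>R l ^ Suc i) = (a (Suc i) - a i) * norm l ^ Suc i"
      using mono[of i] i by (simp only: norm_scaleR norm_power) simp
    also have "\<dots> \<le> (a (Suc i) - a i) * c"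
      using mono[of i] bound[of i] i by (intro mult_left_mono) auto
    finally show "norm ((a (Suc i) - a i) *\<^sub>R l ^ Suc i) \<le> (a (Suc i) - a i) * c" .
  qed
  also have "\<dots> = (a m - a 0) * c"
    by (simp add: sum_distrib_right[symmetric] sum_lessThan_telescope)
  finally show ?thesis .
qed

lemma enestrom_kakeya_upper:
  fixes a :: "nat \<Rightarrow> real" and l :: "'a::real_normed_div_algebra"
  assumes pos: "0 < a 0" and mono: "\<And>i. i < m \<Longrightarrow> a i \<le> a (Suc i)"
    and root: "(\<Sum>i\<le>m. a i *\<^sub>R l ^ i) = 0"
  shows "norm l \<le> 1"
proof (rule ccontr)
  assume "\<not> norm l \<le> 1"
  then have l: "1 < norm l" by simp
  have am: "a 0 \<le> a m"
    using mono by (induction m) (auto intro: order_trans)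
  let ?S = "\<Sum>i<m. (a (Suc i) - a i) *\<^sub>R l ^ Suc i"
  have "a m *\<^sub>R l ^ Suc m = ?S + a 0 *\<^sub>R 1"
    using enestrom_kakeya_identity[of a l m] root by (simp add: algebra_simps)
  then have "norm (a m *\<^sub>R l ^ Suc m) \<le> norm ?S + norm (a 0 *\<^sub>R (1::'a))"
    by (simp only: norm_triangle_ineq)
  moreover have "norm (a m *\<^sub>R l ^ Suc m) = a m * (norm l * norm l ^ m)"
    using pos am by (simp add: norm_mult norm_power)
  moreover have "norm ?S \<le> (a m - a 0) * norm l ^ m"
    using l by (intro norm_increment_sum_le mono power_increasing) auto
  moreover have "norm (a 0 *\<^sub>R (1::'a)) \<le> a 0 * norm l ^ m"
    using pos l by simp
  ultimately have "a m * (norm l * norm l ^ m) \<le> a m * (1 * norm l ^ m)"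
    by (simp add: algebra_simps)
  moreover have "0 < a m" "0 < norm l ^ m" using pos am l by (simp_all add: less_le_trans[of 0 1])
  ultimately have "norm l \<le> 1" by simp
  then show False using l by simp
qed

lemma enestrom_kakeya_lower:
  fixes a :: "nat \<Rightarrow> real" and l :: "'a::real_normed_div_algebra"
  assumes pos: "0 < a 0" and mono: "\<And>i. i < m \<Longrightarrow> a i \<le> a (Suc i)"
    and root: "(\<Sum>i\<le>m. a i *\<^sub>R l ^ i) = 0"
  shows "a 0 \<le> 2 * a m * norm l"
proof -
  have l: "norm l \<le> 1"
    using enestrom_kakeya_upper[OF pos mono root] .
  have am: "a 0 \<le> a m"
    using mono by (induction m) (auto intro: order_trans)
  have pow: "norm l ^ Suc i \<le> norm l" for i
    using power_decreasing[of 1 "Suc i" "norm l"] l by simp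
  let ?S = "\<Sum>i<m. (a (Suc i) - a i) *\<^sub>R l ^ Suc i"
  have "a 0 *\<^sub>R 1 = a m *\<^sub>R l ^ Suc m - ?S"
    using enestrom_kakeya_identity[of a l m] root by (simp add: algebra_simps)
  then have "norm (a 0 *\<^sub>R (1::'a)) \<le> norm (a m *\<^sub>R l ^ Suc m) + norm ?S"
    by (simp only: norm_triangle_ineq4)
  moreover have "norm (a m *\<^sub>R l ^ Suc m) \<le> a m * norm l"
  proof -
    have "norm (a m *\<^sub>R l ^ Suc m) = a m * norm l ^ Suc m"
      using pos am by (simp add: norm_mult norm_power)
    also have "\<dots> \<le> a m * norm l"
      using pos am pow by (intro mult_left_mono) auto
    finally show ?thesis .
  qed
  moreover have "norm ?S \<le> (a m - a 0) * norm l"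
    using pow by (intro norm_increment_sum_le mono) auto
  moreover have "norm (a 0 *\<^sub>R (1::'a)) = a 0" using pos by simp
  ultimately have "a 0 \<le> a m * norm l + (a m - a 0) * norm l" by linarith
  moreover have "0 \<le> a 0 * norm l" using pos by simp
  ultimately show ?thesis by (simp add: algebra_simps)
qed

section \<open>The Rayleigh quotient of a symmetric operator\<close>

lemma symmetric_min_eigenvector:
  fixes T :: "'a::euclidean_space \<Rightarrow> 'a"
  assumes lin: "linear T" and sym: "\<And>x y. x \<bullet> T y = y \<bullet> T x"
    and nontriv: "\<exists>x::'a. x \<noteq> 0"
  obtains u \<mu> where "u \<noteq> 0" "T u = \<mu> *\<^sub>R u" "\<And>x. \<mu> * (norm x)\<^sup>2 \<le> x \<bullet> T x"
proof -
  interpret T: linear T by (rule lin)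
  obtain x0 :: 'a where x0: "x0 \<noteq> 0" using nontriv by blast
  have "sgn x0 \<in> sphere 0 1" using x0 by (simp add: norm_sgn)
  moreover have "continuous_on (sphere 0 1) (\<lambda>x. x \<bullet> T x)"
    by (intro continuous_intros linear_continuous_on)
      (simp add: lin linear_conv_bounded_linear[symmetric])
  ultimately obtain u where u: "u \<in> sphere 0 1"
    and min: "\<And>x. x \<in> sphere 0 1 \<Longrightarrow> u \<bullet> T u \<le> x \<bullet> T x"
    using continuous_attains_inf[of "sphere (0::'a) 1" "\<lambda>x. x \<bullet> T x"] by auto
  define \<mu> where "\<mu> = u \<bullet> T u"
  have norm_u: "norm u = 1" using u by simp
  have low: "\<mu> * (norm x)\<^sup>2 \<le> x \<bullet> T x" for x
  proof (cases "x = 0")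
    case False
    have "\<mu> \<le> sgn x \<bullet> T (sgn x)"
      unfolding \<mu>_def using False by (intro min) (simp add: norm_sgn)
    also have "\<dots> = (x \<bullet> T x) / (norm x)\<^sup>2"
      by (simp add: sgn_div_norm T.scaleR power2_eq_square divide_inverse)
    finally show ?thesis using False by (simp add: pos_le_divide_eq)
  qed simp
  \<comment> \<open>The form of \<open>B = T - \<mu>\<close> is nonnegative and vanishes at \<open>u\<close>; its value at \<open>u + t B u\<close> is
    \<open>2 t |B u|\<^sup>2 + O(t\<^sup>2)\<close>, which is negative for small \<open>t < 0\<close> unless \<open>B u = 0\<close>.\<close>
  define v where "v = T u - \<mu> *\<^sub>R u"
  have expand: "0 \<le> 2 * t * (norm v)\<^sup>2 + t\<^sup>2 * (v \<bullet> T v - \<mu> * (norm v)\<^sup>2)" for t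
  proof -
    have form: "(u + t *\<^sub>R v) \<bullet> T (u + t *\<^sub>R v) = \<mu> + 2 * t * (v \<bullet> T u) + t\<^sup>2 * (v \<bullet> T v)"
      using sym[of u v]
      by (simp add: T.add T.scaleR inner_add_left inner_add_right \<mu>_def power2_eq_square
          algebra_simps)
    have norm: "(norm (u + t *\<^sub>R v))\<^sup>2 = 1 + 2 * t * (v \<bullet> u) + t\<^sup>2 * (norm v)\<^sup>2"
      using norm_u
      by (simp only: power2_norm_eq_inner norm_eq_1)
        (simp add: inner_add_left inner_add_right inner_commute power2_eq_square algebra_simps)
    have "(norm v)\<^sup>2 = v \<bullet> T u - \<mu> * (v \<bullet> u)"
      by (subst power2_norm_eq_inner, subst (2) v_def) (simp add: inner_diff_right)
    then have "v \<bullet> T u = (norm v)\<^sup>2 + \<mu> * (v \<bullet> u)" by simp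
    then show ?thesis
      using low[of "u + t *\<^sub>R v", unfolded form norm] by (simp add: algebra_simps)
  qed
  have "v = 0"
  proof (rule ccontr)
    assume "v \<noteq> 0"
    then have n: "0 < (norm v)\<^sup>2" by simp
    define c where "c = \<bar>v \<bullet> T v - \<mu> * (norm v)\<^sup>2\<bar> + 1"
    define t where "t = (norm v)\<^sup>2 / c"
    have c: "0 < c" by (simp add: c_def)
    have t: "0 < t" using n c by (simp add: t_def)
    have "t\<^sup>2 * (v \<bullet> T v - \<mu> * (norm v)\<^sup>2) \<le> t\<^sup>2 * c"
      by (intro mult_left_mono) (auto simp: c_def)
    also have "\<dots> = t * (norm v)\<^sup>2" using c by (simp add: t_def power2_eq_square)
    finally have "0 \<le> - (t * (norm v)\<^sup>2)" using expand[of "- t"] by simp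
    then show False using t n by (simp add: mult_le_0_iff)
  qed
  then have "T u = \<mu> *\<^sub>R u" by (simp add: v_def)
  moreover have "u \<noteq> 0" using norm_u by auto
  ultimately show thesis using low that by blast
qed

section \<open>Quaternion space as a real Euclidean space\<close>

text \<open>
  Quaternions carry the orthonormal real basis \<open>1, i, j, k\<close>, which makes \<^typ>\<open>quat^'n\<close> a Euclidean
  space and in particular its unit sphere compact.
\<close>

instantiation quat :: euclidean_space
begin

definition Basis_quat :: "quat set" where
  "Basis_quat = {Quat 1 0 0 0, Quat 0 1 0 0, Quat 0 0 1 0, Quat 0 0 0 1}"

instance
proof
  fix u v x :: quat
  show "(Basis :: quat set) \<noteq> {}" "finite (Basis :: quat set)"
    by (simp_all add: Basis_quat_def)
  show "u \<bullet> v = (if u = v then 1 else 0)" if "u \<in> Basis" "v \<in> Basis"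
    using that unfolding Basis_quat_def by (elim insertE emptyE) (simp_all add: inner_quat_def)
  show "(\<forall>u\<in>Basis. x \<bullet> u = 0) \<longleftrightarrow> x = 0"
    unfolding Basis_quat_def quat_eq_iff[of x 0] by (simp add: inner_quat_def)
qed

end

lemma inner_eq_Re_cinner:
  fixes x y :: "quat^'n"
  shows "x \<bullet> y = qRe (cinner x y)"
proof -
  have "qRe (sum f S) = (\<Sum>i\<in>S. qRe (f i))" if "finite S" for f :: "'n \<Rightarrow> quat" and S
    using that by induction auto
  then show ?thesis
    by (simp add: cinner_def inner_vec_def inner_quat_def)
qed

lemma cinner_add_left: "cinner (x + y) z = cinner x z + cinner y z"
proof -
  have "qcnj (a + b) = qcnj a + qcnj b" for a b by (simp add: quat_eq_iff)
  then show ?thesis by (simp add: cinner_def sum.distrib distrib_right)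
qed

lemma cinner_add_right: "cinner x (y + z) = cinner x y + cinner x z"
  by (simp add: cinner_def sum.distrib distrib_left)

lemma cinner_diff_right: "cinner x (y - z) = cinner x y - cinner x z"
  by (simp add: cinner_def sum_subtractf right_diff_distrib)

lemma cinner_sum_right: "cinner x (\<Sum>i\<in>S. f i) = (\<Sum>i\<in>S. cinner x (f i))"
proof (induction S rule: infinite_finite_induct)
  case empty
  show ?case by (simp add: cinner_def)
next
  case (infinite S)
  then show ?case by (simp add: cinner_def)
qed (simp add: cinner_add_right)

lemma cinner_rscale_left: "cinner (x *r c) y = qcnj c * cinner x y"
proof -
  have "qcnj (a * b) = qcnj b * qcnj a" for a b by (simp add: quat_eq_iff)
  then show ?thesis by (simp add: cinner_def rscale_def sum_distrib_left mult.assoc)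
qed

lemma cinner_rscale_right: "cinner x (y *r c) = cinner x y * c"
  by (simp add: cinner_def rscale_def sum_distrib_right mult.assoc)

lemma matrix_vector_mult_rscale: "A *v (y *r c) = (A *v y) *r c"
  by (simp add: vec_eq_iff matrix_vector_mult_def rscale_def sum_distrib_right mult.assoc)

lemma rscale_of_real: "y *r of_real r = r *\<^sub>R y"
  by (simp add: vec_eq_iff rscale_def of_real_def)

lemma matrix_vector_mult_linear_quat: "linear ((*v) (A :: quat^'n^'n))"
  by (rule linearI)
    (simp_all only: matrix_vector_right_distrib matrix_vector_mult_rscale
      rscale_of_real[symmetric])

section \<open>Extreme right eigenvalues of a Hermitian matrix\<close>

text \<open>
  A matrix with real-valued form is symmetric for the real inner product: by polarization
  $x^* A y + y^* A x$ is real for all $x, y$, and replacing $y$ by $y\,i$ shows that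
  $x^* A y$ and $y^* A x$ have the same real part.
\<close>

lemma real_form_imp_symmetric:
  fixes A :: "quat^'n^'n"
  assumes real: "\<And>x. cinner x (A *v x) \<in> \<real>"
  shows "x \<bullet> (A *v y) = y \<bullet> (A *v x)"
proof -
  have I0: "qI z = 0" if "z \<in> \<real>" for z :: quat using that by (auto elim: Reals_cases)
  let ?w = "y *r Quat 0 1 0 0"
  have "cinner (x + ?w) (A *v (x + ?w)) =
      cinner x (A *v x) + cinner ?w (A *v ?w) + (cinner x (A *v ?w) + cinner ?w (A *v x))"
    by (simp add: matrix_vector_right_distrib cinner_add_left cinner_add_right algebra_simps)
  then have "qI (cinner x (A *v ?w) + cinner ?w (A *v x)) = 0"
    using I0[OF real[of "x + ?w"]] I0[OF real[of x]] I0[OF real[of ?w]] by simp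
  then show ?thesis
    by (simp add: matrix_vector_mult_rscale cinner_rscale_left cinner_rscale_right
        inner_eq_Re_cinner)
qed

lemma right_eigenvalue_of_real_iff:
  "right_eigenvalue A (of_real r) \<longleftrightarrow> (\<exists>y. y \<noteq> 0 \<and> A *v y = r *\<^sub>R y)"
  by (simp add: right_eigenvalue_def rscale_of_real)

lemma quat_vec_nontrivial: "\<exists>x::quat^'n. x \<noteq> 0"
  by (rule exI[of _ "1"]) (simp add: vec_eq_iff)

lemma lambda_min_le_form:
  fixes A :: "quat^'n^'n"
  assumes real: "\<And>x. cinner x (A *v x) \<in> \<real>"
  shows "lambda_min A * (norm y)\<^sup>2 \<le> qRe (cinner y (A *v y))"
proof -
  obtain u \<mu> where u: "u \<noteq> 0" "A *v u = \<mu> *\<^sub>R u"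
    and low: "\<And>x. \<mu> * (norm x)\<^sup>2 \<le> x \<bullet> (A *v x)"
    using symmetric_min_eigenvector[OF matrix_vector_mult_linear_quat
        real_form_imp_symmetric[OF real] quat_vec_nontrivial] by metis
  have "lambda_min A = \<mu>"
    unfolding lambda_min_def
  proof (rule Least_equality)
    show "right_eigenvalue A (of_real \<mu>)"
      using u by (auto simp: right_eigenvalue_of_real_iff)
  next
    fix r assume "right_eigenvalue A (of_real r)"
    then obtain z where z: "z \<noteq> 0" "A *v z = r *\<^sub>R z"
      by (auto simp: right_eigenvalue_of_real_iff)
    show "\<mu> \<le> r" using low[of z] z by (simp add: power2_norm_eq_inner)
  qed
  then show ?thesis using low[of y] by (simp add: inner_eq_Re_cinner)
qed

lemma form_le_lambda_max:
  fixes A :: "quat^'n^'n"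
  assumes real: "\<And>x. cinner x (A *v x) \<in> \<real>"
  shows "qRe (cinner y (A *v y)) \<le> lambda_max A * (norm y)\<^sup>2"
proof -
  \<comment> \<open>The largest eigenvalue of \<open>A\<close> is minus the smallest eigenvalue of \<open>- A\<close>.\<close>
  have "linear (\<lambda>x. - (A *v x))"
    by (rule linear_compose_neg[OF matrix_vector_mult_linear_quat])
  moreover have "x \<bullet> - (A *v z) = z \<bullet> - (A *v x)" for x z
    using real_form_imp_symmetric[OF real, of x z] by simp
  ultimately obtain u \<mu> where u: "u \<noteq> 0" "- (A *v u) = \<mu> *\<^sub>R u"
    and low: "\<And>x. \<mu> * (norm x)\<^sup>2 \<le> x \<bullet> - (A *v x)"
    using symmetric_min_eigenvector[of "\<lambda>x. - (A *v x)"] quat_vec_nontrivial by metis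
  have "lambda_max A = - \<mu>"
    unfolding lambda_max_def
  proof (rule Greatest_equality)
    have "A *v u = (- \<mu>) *\<^sub>R u" using u(2) by (metis minus_minus scaleR_minus_left)
    then show "right_eigenvalue A (of_real (- \<mu>))"
      using u(1) unfolding right_eigenvalue_of_real_iff by blast
  next
    fix r assume "right_eigenvalue A (of_real r)"
    then obtain z where z: "z \<noteq> 0" "A *v z = r *\<^sub>R z"
      by (auto simp: right_eigenvalue_of_real_iff)
    have "\<mu> * (norm z)\<^sup>2 \<le> (- r) * (norm z)\<^sup>2"
      using low[of z] z by (simp add: power2_norm_eq_inner)
    then have "\<mu> \<le> - r" using z(1) by (subst (asm) mult_le_cancel_right_pos) auto
    then show "r \<le> - \<mu>" by simp
  qed
  then show ?thesis using low[of y] by (simp flip: inner_eq_Re_cinner)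
qed

section \<open>Right eigenvalues of the matrix polynomial\<close>

lemma loewner_geD:
  assumes "A \<succeq> B" and "cinner x (B *v x) \<in> \<real>"
  shows "cinner x (A *v x) \<in> \<real>" and "qRe (cinner x (B *v x)) \<le> qRe (cinner x (A *v x))"
proof -
  have eq: "cinner x ((A - B) *v x) = cinner x (A *v x) - cinner x (B *v x)"
    by (simp add: matrix_vector_mult_diff_rdistrib cinner_diff_right)
  have d: "cinner x ((A - B) *v x) \<in> \<real>" "0 \<le> qRe (cinner x ((A - B) *v x))"
    using assms(1) by (auto simp: loewner_ge_def psd_def)
  show "cinner x (A *v x) \<in> \<real>"
    using Reals_add[OF d(1) assms(2)] by (simp add: eq)
  show "qRe (cinner x (B *v x)) \<le> qRe (cinner x (A *v x))"
    using d(2) by (simp add: eq)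
qed

theorem theorem4p23:
  fixes A :: "nat \<Rightarrow> quat^'n^'n" and m :: nat and l :: quat
  assumes mono: "\<And>i. i < m \<Longrightarrow> A (Suc i) \<succeq> A i"
    and pd0: "pd (A 0)"
    and eig: "poly_right_eigenvalue m A l"
  shows "lambda_min (A 0) / (2 * lambda_max (A m)) \<le> norm l \<and> norm l \<le> 1"
proof -
  obtain y where y: "y \<noteq> 0" and root: "(\<Sum>i\<le>m. (A i *v y) *r l ^ i) = 0"
    using eig by (auto simp: poly_right_eigenvalue_def)
  have real0: "cinner x (A 0 *v x) \<in> \<real>" for x
    using pd0 by (cases "x = 0") (auto simp: pd_def cinner_def)
  have real: "cinner x (A i *v x) \<in> \<real>" if "i \<le> m" for i x
    using that by (induction i) (auto simp: Suc_le_eq intro: real0 loewner_geD(1)[OF mono])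
  define a where "a i = qRe (cinner y (A i *v y))" for i
  have form: "cinner y (A i *v y) = of_real (a i)" if "i \<le> m" for i
    using real[OF that, of y] by (auto simp: a_def elim: Reals_cases)
  have pos: "0 < a 0" using pd0 y by (simp add: a_def pd_def)
  have incr: "a i \<le> a (Suc i)" if "i < m" for i
    unfolding a_def using that by (intro loewner_geD(2) mono real) auto
  have "(\<Sum>i\<le>m. a i *\<^sub>R l ^ i) = cinner y (\<Sum>i\<le>m. (A i *v y) *r l ^ i)"
    by (simp add: cinner_sum_right cinner_rscale_right form scaleR_conv_of_real)
  also have "\<dots> = 0" unfolding root by (simp add: cinner_def)
  finally have scalar: "(\<Sum>i\<le>m. a i *\<^sub>R l ^ i) = 0" .
  have upper: "norm l \<le> 1"
    using enestrom_kakeya_upper[OF pos incr scalar] .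
  have a0: "a 0 \<le> 2 * a m * norm l"
    using enestrom_kakeya_lower[OF pos incr scalar] .
  have "0 < a m * norm l" using pos a0 by simp
  then have am: "0 < a m" by (simp add: zero_less_mult_iff)
  have n: "0 < (norm y)\<^sup>2" using y by simp
  have max: "a m \<le> lambda_max (A m) * (norm y)\<^sup>2"
    unfolding a_def by (intro form_le_lambda_max real) simp
  have max_pos: "0 < lambda_max (A m)"
    using am max n by (metis less_le_trans zero_less_mult_pos2)
  have "lambda_min (A 0) * (norm y)\<^sup>2 \<le> a 0"
    unfolding a_def by (intro lambda_min_le_form real0)
  also have "\<dots> \<le> 2 * (lambda_max (A m) * (norm y)\<^sup>2) * norm l"
    using a0 mult_right_mono[OF max norm_ge_zero[of l]] by simp
  finally have "lambda_min (A 0) * (norm y)\<^sup>2 \<le> (norm l * (2 * lambda_max (A m))) * (norm y)\<^sup>2"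
    by (simp add: mult_ac)
  then have "lambda_min (A 0) \<le> norm l * (2 * lambda_max (A m))"
    using n by simp
  then show ?thesis using max_pos upper by (simp add: pos_divide_le_eq)
qed

end
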